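(* Let $X,Y$ be indeterminates and let $L^{(2)}_n(x;X,Y)$ be the monic polynomials defined by $L^{(2)}_{-1}=0$, $L^{(2)}_0=1$ and $L^{(2)}_{n+1}=(x-b_n)L^{(2)}_n-\lambda_nL^{(2)}_{n-1}$ for $n\ge0$, where $b_0=X$, $b_n=2n+X+Y-1$ for $n>0$, and $\lambda_n=(n-1+X)(n-1+Y)$. Then for every non-negative integer $n$, \[ L^{(2)}_n(x;X,Y)=\sum_{k=0}^n (X+k)_{n-k}\binom{n}{k}\, {}_3F_2\!\left(\begin{matrix}k-n,\ k,\ Y-1\\ -n,\ X+k\end{matrix};1\right)(-1)^{n-k}x^k . \]
   Context: $(a)_m=a(a+1)\cdots(a+m-1)$ with $(a)_0=1$. ${}_3F_2\!\left(\begin{matrix}a_1,a_2,a_3\\ b_1,b_2\end{matrix};z\right)=\sum_{j\ge0}\frac{(a_1)_j(a_2)_j(a_3)_j}{(b_1)_j(b_2)_j\,j!}z^j$; here the series terminates at $j=n-k$ because of the numerator parameter $k-n$. *)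

theory Defs
  imports
    "HOL-Computational_Algebra.Computational_Algebra"
    "HOL-Library.Groups_Big_Fun"
begin

text \<open>The indeterminates \<open>X\<close> and \<open>Y\<close> are the two generators of the field of rational
  functions \<open>Frac (R[X][Y])\<close>; the polynomial variable \<open>x\<close> is the generator of the
  polynomial ring over that field.\<close>

definition indet_X :: "'r::idom poly poly fract" where
  "indet_X = Fract [:[:0, 1:]:] 1"

definition indet_Y :: "'r::idom poly poly fract" where
  "indet_Y = Fract [:0, 1:] 1"

definition L2_b :: "'a::comm_ring_1 \<Rightarrow> 'a \<Rightarrow> nat \<Rightarrow> 'a" where
  "L2_b X Y n = (if n = 0 then X else 2 * of_nat n + X + Y - 1)"

definition L2_lambda :: "'a::comm_ring_1 \<Rightarrow> 'a \<Rightarrow> nat \<Rightarrow> 'a" where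
  "L2_lambda X Y n = (of_nat n - 1 + X) * (of_nat n - 1 + Y)"

text \<open>The conditional encodes the initial value at index \<open>-1\<close>, which is \<open>0\<close>.\<close>

fun L2 :: "'a::comm_ring_1 \<Rightarrow> 'a \<Rightarrow> nat \<Rightarrow> 'a poly" where
  "L2 X Y 0 = 1"
| "L2 X Y (Suc n) =
     ([:0, 1:] - [:L2_b X Y n:]) * L2 X Y n
     - [:L2_lambda X Y n:] * (if n = 0 then 0 else L2 X Y (n - 1))"

definition hyp3F2_term :: "'a::field \<Rightarrow> 'a \<Rightarrow> 'a \<Rightarrow> 'a \<Rightarrow> 'a \<Rightarrow> 'a \<Rightarrow> nat \<Rightarrow> 'a" where
  "hyp3F2_term a1 a2 a3 b1 b2 z j =
     pochhammer a1 j * pochhammer a2 j * pochhammer a3 j /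
       (pochhammer b1 j * pochhammer b2 j * of_nat (fact j)) * z ^ j"

text \<open>Only terminating series are meant: \<open>Sum_any\<close> adds up the nonzero terms, provided that
  there are finitely many. Beyond the point where a numerator parameter has made the numerator
  vanish, the terms are \<open>0\<close> even if the denominator vanishes as well, so the series stops there.\<close>

definition hyp3F2 :: "'a::field \<Rightarrow> 'a \<Rightarrow> 'a \<Rightarrow> 'a \<Rightarrow> 'a \<Rightarrow> 'a \<Rightarrow> 'a" where
  "hyp3F2 a1 a2 a3 b1 b2 z = Sum_any (hyp3F2_term a1 a2 a3 b1 b2 z)"

lemma hyp3F2_terminating:
  "hyp3F2 (- of_nat N) a2 a3 b1 b2 z = (\<Sum>j\<le>N. hyp3F2_term (- of_nat N) a2 a3 b1 b2 z j)"
proof -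
  have "hyp3F2_term (- of_nat N) a2 a3 b1 b2 z j = 0" if "N < j" for j
    using that by (simp add: hyp3F2_term_def pochhammer_of_nat_eq_0_lemma)
  hence "{j. hyp3F2_term (- of_nat N) a2 a3 b1 b2 z j \<noteq> 0} \<subseteq> {..N}"
    using linorder_not_le by blast
  thus ?thesis
    unfolding hyp3F2_def by (rule Sum_any.expand_superset[OF finite_atMost])
qed

end

theory Submission
  imports Defs
begin

text \<open>
  After cancelling Pochhammer symbols, the coefficient of \<open>x^k\<close> in the claimed formula is
  \<open>(-1)^(n-k)\<close> times the sum over \<open>j\<close> of
  \<open>binomial(n-j, k) binomial(k+j-1, j) (X+k+j)_(n-k-j) (Y-1)_j\<close>, which involves no division.
  The three-term recurrence multiplies this sum by polynomials in \<open>Y\<close>; expanding with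
  \<open>(Y-1) (Y-1)_j = (Y-1)_(j+1) - j (Y-1)_j\<close>, it already holds separately for the coefficient
  of each \<open>(Y-1)_j\<close>, by Pascal's rule and absorption of binomial coefficients.
\<close>

text \<open>Needed to cancel binomial coefficients and factorials in the hypergeometric
  terms.\<close>

instance fract :: ("{idom,ring_char_0}") field_char_0
proof
  show "inj (of_nat :: nat \<Rightarrow> 'a fract)"
    by (auto intro!: injI simp: of_nat_fract eq_fract)
qed

section \<open>Division-free form of the coefficients\<close>

text \<open>Truncated subtraction does no harm: the binomial factors vanish whenever \<open>n < k + j\<close>,
  and at \<open>k = 0\<close> only \<open>j = 0\<close> contributes.\<close>

definition L2_term :: "'a::comm_ring_1 \<Rightarrow> nat \<Rightarrow> nat \<Rightarrow> nat \<Rightarrow> 'a" where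
  "L2_term X n k j = of_nat (((n - j) choose k) * ((k + j - 1) choose j))
     * pochhammer (X + of_nat (k + j)) (n - k - j)"

text \<open>The coefficient of \<open>x^k\<close> in \<open>L2 X Y n\<close> up to sign. The range
  is independent of \<open>k\<close>; summands with \<open>n < k + j\<close> vanish.\<close>

definition L2_coeff :: "'a::comm_ring_1 \<Rightarrow> 'a \<Rightarrow> nat \<Rightarrow> nat \<Rightarrow> 'a" where
  "L2_coeff X Y n k = (\<Sum>j\<le>n. L2_term X n k j * pochhammer (Y - 1) j)"

lemma L2_term_eq_0:
  assumes "n < k + j"
  shows "L2_term X n k j = 0"
proof (cases "k = 0")
  case True
  then show ?thesis
    using assms by (simp add: L2_term_def binomial_eq_0)
next
  case False
  then have "n - j < k"
    using assms by linarith
  then show ?thesis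
    by (simp add: L2_term_def binomial_eq_0)
qed

text \<open>Lets coefficients with different \<open>n\<close> be summed over one common
  range.\<close>

lemma L2_coeff_eq_sum:
  assumes "n \<le> N"
  shows "L2_coeff X Y n k = (\<Sum>j\<le>N. L2_term X n k j * pochhammer (Y - 1) j)"
  unfolding L2_coeff_def
  by (rule sum.mono_neutral_left) (use assms in \<open>auto simp: L2_term_eq_0\<close>)

lemma L2_coeff_eq_0: "n < k \<Longrightarrow> L2_coeff X Y n k = 0"
  by (simp add: L2_coeff_def L2_term_eq_0)

lemma L2_term_0: "L2_term X n 0 j = (if j = 0 then pochhammer X n else 0)"
  by (cases j) (auto simp: L2_term_def binomial_eq_0)

lemma L2_coeff_0: "L2_coeff X Y n 0 = pochhammer X n"
  by (simp add: L2_coeff_def L2_term_0 if_distrib[of "\<lambda>a. a * _"] cong: if_cong)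

section \<open>The recurrence for single terms\<close>

text \<open>Pascal's rule twice, with \<open>j = Suc i\<close>: it merges the two terms of the case
  distinction, and then \<open>(k + i) choose i\<close> and \<open>(k + i) choose j\<close> into
  \<open>(k + j) choose j\<close>.\<close>

lemma L2_term_shift_sum:
  fixes X :: "'a::comm_ring_1"
  assumes "k + j \<le> n + 1"
  shows "L2_term X (n + 1) k j
      + (case j of 0 \<Rightarrow> 0 | Suc i \<Rightarrow> L2_term X (n + 1) (k + 1) i - (of_nat n + X) * L2_term X n (k + 1) i)
    = of_nat (((n + 1 - j) choose k) * ((k + j) choose j))
        * pochhammer (X + of_nat (k + j)) (n + 1 - k - j)"
proof (cases j)
  case 0
  then show ?thesis by (simp add: L2_term_def)
next
  case (Suc i)
  have n: "k + i \<le> n"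
    using assms Suc by simp
  define P where "P = pochhammer (X + of_nat (k + j)) (n - k - i)"
  have t1: "L2_term X (n + 1) k j
      = of_nat (((n - i) choose k) * ((k + i) choose j)) * P"
    by (simp add: L2_term_def P_def Suc)
  have t2: "L2_term X (n + 1) (k + 1) i
      = of_nat (((Suc (n - i)) choose (k + 1)) * ((k + i) choose i)) * P"
    using n by (simp add: L2_term_def P_def Suc Suc_diff_le add.assoc)
  \<comment> \<open>\<open>of_nat n + X\<close> is the last factor of \<open>P\<close>, missing from
    the shorter Pochhammer symbol of the term. At \<open>k + i = n\<close> the empty product
    \<open>P\<close> has no such factor, but there the binomial coefficient vanishes.\<close>
  have t3: "(of_nat n + X) * L2_term X n (k + 1) i
      = of_nat (((n - i) choose (k + 1)) * ((k + i) choose i)) * P"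
  proof (cases "k + i = n")
    case True
    then have "n - i = k" by linarith
    then show ?thesis by (simp add: L2_term_def binomial_eq_0)
  next
    case False
    then obtain d where d: "n = k + i + Suc d"
      using n less_iff_Suc_add[of "k + i" n] by auto
    then have "n - k - i = Suc d" "n - (k + 1) - i = d"
      by simp_all
    then show ?thesis
      unfolding L2_term_def P_def Suc
      by (simp add: pochhammer_Suc d algebra_simps)
  qed
  have c: "(k + j) choose j = ((k + i) choose i) + ((k + i) choose j)"
    by (simp add: Suc)
  have t23: "(case j of 0 \<Rightarrow> 0 | Suc i \<Rightarrow> L2_term X (n + 1) (k + 1) i - (of_nat n + X) * L2_term X n (k + 1) i)
      = of_nat (((n - i) choose k) * ((k + i) choose i)) * P"
    unfolding Suc nat.case t2 t3 by (simp add: algebra_simps)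
  have m: "n + 1 - j = n - i" "n + 1 - k - j = n - k - i"
    by (simp_all add: Suc)
  show ?thesis
    unfolding t1 c m t23 P_def[symmetric] by (simp add: algebra_simps)
qed

text \<open>With \<open>Z = Y - 1\<close> the recurrence has coefficients
  \<open>2 * (n + 1) + X + Z\<close> and \<open>(n + X) * (n + 1 + Z)\<close>. Replacing
  \<open>Z * (Z)_j\<close> by \<open>(Z)_(j+1) - j * (Z)_j\<close> and comparing the factors of
  \<open>(Z)_j\<close> gives this identity.\<close>

lemma L2_term_rec:
  fixes X :: "'a::comm_ring_1"
  shows "L2_term X (n + 2) (k + 1) j =
    L2_term X (n + 1) k j
    + (2 * of_nat (n + 1) + X - of_nat j) * L2_term X (n + 1) (k + 1) j
    - (of_nat n + X) * (of_nat (n + 1) - of_nat j) * L2_term X n (k + 1) j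
    + (case j of 0 \<Rightarrow> 0 | Suc i \<Rightarrow> L2_term X (n + 1) (k + 1) i - (of_nat n + X) * L2_term X n (k + 1) i)"
proof (cases "k + j \<le> n + 1")
  case False
  then show ?thesis
    by (auto simp: L2_term_eq_0 split: nat.split)
next
  case True
  note shift = L2_term_shift_sum[OF True, of X]
  show ?thesis
  proof (cases "k + j = n + 1")
    \<comment> \<open>The \<open>i = n - k - j\<close> of the main case would be -1 here; both sides
      reduce to \<open>(k + j) choose j\<close>.\<close>
    case eq: True
    then have "n + 2 - j = k + 1" "n + 1 - j = k"
      by linarith+
    then have "L2_term X (n + 2) (k + 1) j = of_nat ((k + j) choose j)"
      using eq by (simp add: L2_term_def)
    moreover have "L2_term X (n + 1) (k + 1) j = 0" "L2_term X n (k + 1) j = 0"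
      using eq by (simp_all add: L2_term_eq_0)
    ultimately show ?thesis
      using shift eq \<open>n + 1 - j = k\<close> by simp
  next
    case False
    then obtain i where n: "n = k + j + i"
      using True le_Suc_ex[of "k + j" n] by auto
    \<comment> \<open>Each Pochhammer symbol is \<open>P\<close> up to at most one linear factor at
      either end, and \<open>c\<close> is common to all terms, so only relations between
      neighbouring binomial coefficients remain.\<close>
    define q where "q = X + of_nat (k + j)"
    define P where "P = pochhammer (q + 1) i"
    define c where "c = (of_nat ((k + j) choose j) :: 'a)"
    define B B' D where "B = (of_nat ((k + 1 + i) choose (k + 1)) :: 'a)"
      and "B' = (of_nat ((k + 1 + i) choose k) :: 'a)"
      and "D = (of_nat ((k + i) choose (k + 1)) :: 'a)"
    have m: "n + 2 - j = Suc (k + 1 + i)" "n + 1 - j = k + 1 + i" "n - j = k + i"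
      "n + 2 - (k + 1) - j = Suc i" "n + 1 - (k + 1) - j = i" "n + 1 - k - j = Suc i"
      by (simp_all add: n)
    have t1: "L2_term X (n + 2) (k + 1) j = (B + B') * c * (P * (q + 1 + of_nat i))"
      unfolding L2_term_def m
      by (simp add: P_def q_def pochhammer_Suc B_def B'_def c_def algebra_simps)
    have t2: "L2_term X (n + 1) (k + 1) j = B * c * P"
      unfolding L2_term_def m by (simp add: P_def q_def B_def c_def algebra_simps)
    have "(k + 1 + i) * ((k + i) choose (k + 1)) = i * ((k + 1 + i) choose (k + 1))"
      using binomial_absorb_comp[of "k + 1 + i" "k + 1"] by simp
    from arg_cong[OF this, of "of_nat :: nat \<Rightarrow> 'a"]
    have D: "(of_nat k + 1 + of_nat i) * D = of_nat i * B"
      by (simp only: D_def B_def of_nat_add of_nat_mult of_nat_1)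
    have t3: "(of_nat n + X) * (of_nat (n + 1) - of_nat j) * L2_term X n (k + 1) j
        = of_nat i * B * c * P"
    proof (cases i)
      case 0
      then show ?thesis by (simp add: L2_term_eq_0 n)
    next
      case (Suc d)
      have "L2_term X n (k + 1) j = D * c * pochhammer (q + 1) d"
        unfolding L2_term_def m
        by (simp add: q_def D_def c_def n Suc algebra_simps)
      moreover have "P = pochhammer (q + 1) d * (of_nat n + X)"
        by (simp add: P_def Suc pochhammer_Suc q_def n algebra_simps)
      moreover have "(of_nat (n + 1) - of_nat j :: 'a) = of_nat k + 1 + of_nat i"
        by (simp add: n)
      ultimately have "(of_nat n + X) * (of_nat (n + 1) - of_nat j) * L2_term X n (k + 1) j
        = ((of_nat k + 1 + of_nat i) * D) * c * P"
        by (simp only: mult_ac)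
      then show ?thesis by (simp only: D)
    qed
    have t4: "of_nat (((n + 1 - j) choose k) * ((k + j) choose j))
        * pochhammer (X + of_nat (k + j)) (n + 1 - k - j) = B' * c * (q * P)"
      unfolding m by (simp add: pochhammer_rec P_def q_def B'_def c_def)
    have "(k + 1) * ((k + 1 + i) choose (k + 1)) = (i + 1) * ((k + 1 + i) choose k)"
      using binomial_absorption[of k "k + 1 + i"] binomial_absorb_comp[of "k + 1 + i" k] by simp
    from arg_cong[OF this, of "of_nat :: nat \<Rightarrow> 'a"]
    have B: "(of_nat k + 1) * B = (of_nat i + 1) * B'"
      by (simp only: B_def B'_def of_nat_add of_nat_mult of_nat_1)
    \<comment> \<open>Up to the factor \<open>c * P\<close>, the two sides differ by
      \<open>(i + 1) * B' - (k + 1) * B\<close>, which is zero by fact \<open>B\<close>.\<close>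
    have key: "(B + B') * c * (P * (q + 1 + of_nat i))
        = B' * c * (q * P) + (2 * of_nat (n + 1) + X - of_nat j) * (B * c * P)
          - of_nat i * B * c * P"
    proof -
      have b: "2 * of_nat (n + 1) + X - of_nat j = q + 1 + of_nat i + of_nat i + (of_nat k + 1)"
        by (simp add: n q_def algebra_simps)
      have "B' * c * (q * P) + (2 * of_nat (n + 1) + X - of_nat j) * (B * c * P)
          - of_nat i * B * c * P
        = B' * c * (q * P) + (q + 1 + of_nat i) * B * c * P + ((of_nat k + 1) * B) * c * P"
        unfolding b by (simp add: algebra_simps)
      also have "\<dots> = (B + B') * c * (P * (q + 1 + of_nat i))"
        unfolding B by (simp add: algebra_simps)
      finally show ?thesis by simp
    qed
    show ?thesis
      unfolding t3 using shift unfolding t4 t1 t2 key by (simp add: algebra_simps)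
  qed
qed

section \<open>The recurrence for the coefficients\<close>

text \<open>Reindexing the part with \<open>pochhammer Z (Suc j)\<close> produces the case
  distinction and the extra summand.\<close>

lemma sum_mult_pochhammer_shift:
  fixes Z :: "'a::comm_ring_1"
  shows "(\<Sum>j\<le>N. Z * (f j * pochhammer Z j)) =
    (\<Sum>j\<le>Suc N. (case j of 0 \<Rightarrow> 0 | Suc i \<Rightarrow> f i) * pochhammer Z j)
    - (\<Sum>j\<le>N. of_nat j * f j * pochhammer Z j)"
  unfolding sum.atMost_Suc_shift
  by (simp add: pochhammer_Suc sum_subtractf[symmetric] algebra_simps)

lemma L2_coeff_rec:
  fixes X :: "'a::comm_ring_1"
  shows "L2_coeff X Y (n + 2) (k + 1) =
    L2_coeff X Y (n + 1) k + L2_b X Y (n + 1) * L2_coeff X Y (n + 1) (k + 1)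
    - L2_lambda X Y (n + 1) * L2_coeff X Y n (k + 1)"
proof -
  define Z where "Z = Y - 1"
  \<comment> \<open>\<open>f\<close> collects what multiplies \<open>Z\<close>: at index
    \<open>n + 1\<close>, \<open>L2_b\<close> and \<open>L2_lambda\<close> are linear in
    \<open>Z\<close> with leading coefficients 1 and \<open>n + X\<close>.\<close>
  define f where "f i = L2_term X (n + 1) (k + 1) i - (of_nat n + X) * L2_term X n (k + 1) i" for i
  let ?N = "n + 1"
  have f_top: "f (Suc ?N) = 0" "L2_term X (n + 1) k (Suc ?N) = 0"
    "L2_term X (n + 1) (k + 1) (Suc ?N) = 0" "L2_term X n (k + 1) (Suc ?N) = 0"
    by (simp_all add: f_def L2_term_eq_0)
  have "L2_coeff X Y (n + 2) (k + 1) = (\<Sum>j\<le>Suc ?N. L2_term X (n + 2) (k + 1) j * pochhammer Z j)"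
    by (simp add: L2_coeff_def Z_def)
  also have "\<dots> = (\<Sum>j\<le>Suc ?N. L2_term X (n + 1) k j * pochhammer Z j
      + (2 * of_nat (n + 1) + X) * (L2_term X (n + 1) (k + 1) j * pochhammer Z j)
      - (of_nat n + X) * of_nat (n + 1) * (L2_term X n (k + 1) j * pochhammer Z j)
      - of_nat j * f j * pochhammer Z j
      + (case j of 0 \<Rightarrow> 0 | Suc i \<Rightarrow> f i) * pochhammer Z j)"
    by (intro sum.cong refl, subst L2_term_rec, unfold f_def) (simp only: algebra_simps)
  also have "\<dots> = L2_coeff X Y (n + 1) k
      + (2 * of_nat (n + 1) + X) * L2_coeff X Y (n + 1) (k + 1)
      - (of_nat n + X) * of_nat (n + 1) * L2_coeff X Y n (k + 1)
      + ((\<Sum>j\<le>Suc ?N. (case j of 0 \<Rightarrow> 0 | Suc i \<Rightarrow> f i) * pochhammer Z j)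
         - (\<Sum>j\<le>?N. of_nat j * f j * pochhammer Z j))"
    unfolding L2_coeff_eq_sum[of "n + 1" "Suc ?N", OF le_SucI[OF order.refl]]
      L2_coeff_eq_sum[of n "Suc ?N", OF le_SucI[OF le_add1]] sum.distrib sum_subtractf
      sum_distrib_left[symmetric]
    using f_top by (simp add: Z_def)
  also have "(\<Sum>j\<le>Suc ?N. (case j of 0 \<Rightarrow> 0 | Suc i \<Rightarrow> f i) * pochhammer Z j)
         - (\<Sum>j\<le>?N. of_nat j * f j * pochhammer Z j)
       = Z * (L2_coeff X Y (n + 1) (k + 1) - (of_nat n + X) * L2_coeff X Y n (k + 1))"
    unfolding sum_mult_pochhammer_shift[symmetric]
      L2_coeff_eq_sum[of "n + 1" ?N, OF order.refl] L2_coeff_eq_sum[of n ?N, OF le_add1]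
    by (simp only: f_def Z_def sum_distrib_left sum_subtractf[symmetric])
      (simp only: algebra_simps)
  finally show ?thesis
    by (simp add: L2_b_def L2_lambda_def Z_def algebra_simps)
qed

text \<open>The sign turns the \<open>- b\<close> of the recurrence into the \<open>+ b\<close> of
  \<open>L2_coeff_rec\<close> and preserves \<open>- lambda\<close>. The exponent
  \<open>n + k\<close> has the parity of \<open>n - k\<close> but is not truncated for
  \<open>k > n\<close>.\<close>

lemma coeff_L2:
  fixes X :: "'a::comm_ring_1"
  shows "coeff (L2 X Y n) k = (- 1) ^ (n + k) * L2_coeff X Y n k"
proof (induction n arbitrary: k rule: induct_nat_012)
  case 0
  then show ?case
    by (cases k) (simp_all add: L2_coeff_0 L2_coeff_eq_0)
next
  \<comment> \<open>A separate base case, since \<open>b\<close> at index 0 is \<open>X\<close> and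
    does not fit the general formula.\<close>
  case 1
  have "L2_coeff X Y 1 1 = 1"
    by (simp add: L2_coeff_def L2_term_def)
  moreover have "L2_coeff X Y 1 (Suc (Suc i)) = 0" for i
    by (simp add: L2_coeff_eq_0)
  ultimately show ?case
    by (auto simp: L2_coeff_0 L2_b_def coeff_pCons split: nat.split)
next
  case (ge2 n)
  have L2: "L2 X Y (Suc (Suc n)) = pCons 0 (L2 X Y (Suc n))
      - smult (L2_b X Y (Suc n)) (L2 X Y (Suc n)) - smult (L2_lambda X Y (Suc n)) (L2 X Y n)"
    unfolding L2.simps(2)[of X Y "Suc n"] by (simp add: algebra_simps del: L2.simps)
  show ?case
  proof (cases k)
    \<comment> \<open>\<open>L2_lambda X Y (n + 1) * pochhammer X n\<close> equals
      \<open>(n + Y) * pochhammer X (n + 1)\<close>, and \<open>b - (n + Y) = X + n + 1\<close> is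
      the next factor of the Pochhammer symbol.\<close>
    case 0
    then show ?thesis
      unfolding L2
      by (simp add: ge2.IH L2_coeff_0 pochhammer_Suc L2_b_def L2_lambda_def algebra_simps
          del: L2.simps)
  next
    case (Suc i)
    have "L2_coeff X Y (Suc (Suc n)) (Suc i) = L2_coeff X Y (Suc n) i
        + L2_b X Y (Suc n) * L2_coeff X Y (Suc n) (Suc i)
        - L2_lambda X Y (Suc n) * L2_coeff X Y n (Suc i)"
      using L2_coeff_rec[of X Y n i] by simp
    then show ?thesis
      unfolding L2 Suc by (simp add: ge2.IH right_diff_distrib distrib_left mult_ac del: L2.simps)
  qed
qed

section \<open>Comparison with the hypergeometric series\<close>

text \<open>Truncation at \<open>k = 0\<close> is harmless: both sides are 1 for
  \<open>j = 0\<close> and vanish for \<open>j > 0\<close>.\<close>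

lemma pochhammer_of_nat_binomial:
  "pochhammer (of_nat k :: 'a::field_char_0) j = of_nat ((k + j - 1) choose j) * fact j"
proof (cases k)
  case 0
  then show ?thesis
    by (cases j) (simp_all add: pochhammer_0_left)
next
  case (Suc i)
  then have "(of_nat (k + j - 1) - of_nat j + 1 :: 'a) = of_nat k"
    by simp
  then show ?thesis
    using gbinomial_pochhammer'[of "of_nat (k + j - 1) :: 'a" j]
    by (simp add: binomial_gbinomial)
qed

lemma pochhammer_minus_of_nat_binomial:
  "pochhammer (- of_nat n :: 'a::field_char_0) j = (- 1) ^ j * of_nat (n choose j) * fact j"
  using gbinomial_pochhammer[of "of_nat n :: 'a" j]
  by (simp add: binomial_gbinomial[symmetric] minus_one_power_iff split: if_splits)

text \<open>The denominator \<open>(X + k)_j\<close> cancels the first \<open>j\<close> factors of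
  \<open>(X + k)_(n-k)\<close>. The signs and factorials cancel too, leaving an identity of binomial
  coefficients.\<close>

lemma hyp3F2_term_eq_L2_term:
  fixes X Y :: "'a::field_char_0"
  assumes X: "\<And>i. X + of_nat i \<noteq> 0" and "k + j \<le> n"
  shows "pochhammer (X + of_nat k) (n - k) * of_nat (n choose k)
      * hyp3F2_term (- of_nat (n - k)) (of_nat k) (Y - 1) (- of_nat n) (X + of_nat k) 1 j
    = L2_term X n k j * pochhammer (Y - 1) j"
proof -
  have "n - k = j + (n - k - j)"
    using assms(2) by simp
  then have P: "pochhammer (X + of_nat k) (n - k)
      = pochhammer (X + of_nat k) j * pochhammer (X + of_nat (k + j)) (n - k - j)"
    using pochhammer_product'[of "X + of_nat k" j "n - k - j"] by (simp add: add.assoc)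
  have "X + of_nat k \<noteq> - of_nat i" for i
    using X[of "k + i"] by (metis add.assoc add_eq_0_iff2 of_nat_add)
  then have nz: "pochhammer (X + of_nat k) j \<noteq> 0"
    by (simp add: pochhammer_eq_0_iff)
  \<comment> \<open>Both products equal the trinomial coefficient
    \<open>n! / (k! j! (n - k - j)!)\<close>.\<close>
  have "(n choose k) * ((n - k) choose j) = (n choose j) * ((n - j) choose k)"
    using choose_mult[of k "k + j" n] choose_mult[of j "k + j" n] assms(2)
    by (simp add: binomial_symmetric[of k "k + j"])
  then have "of_nat (n choose k) * of_nat ((n - k) choose j)
      = (of_nat (n choose j) * of_nat ((n - j) choose k) :: 'a)"
    by (metis of_nat_mult)
  moreover have "(of_nat (n choose j) :: 'a) \<noteq> 0"
    using assms(2) by simp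
  ultimately show ?thesis
    unfolding hyp3F2_term_def L2_term_def pochhammer_minus_of_nat_binomial
      pochhammer_of_nat_binomial P
    using nz by (simp add: field_simps)
qed

lemma hyp3F2_eq_L2_coeff:
  fixes X Y :: "'a::field_char_0"
  assumes X: "\<And>i. X + of_nat i \<noteq> 0" and "k \<le> n"
  shows "pochhammer (X + of_nat k) (n - k) * of_nat (n choose k)
      * hyp3F2 (of_nat k - of_nat n) (of_nat k) (Y - 1) (- of_nat n) (X + of_nat k) 1
    = L2_coeff X Y n k"
proof -
  have top: "(of_nat k - of_nat n :: 'a) = - of_nat (n - k)"
    using assms(2) by (simp add: of_nat_diff)
  have "pochhammer (X + of_nat k) (n - k) * of_nat (n choose k)
      * hyp3F2 (of_nat k - of_nat n) (of_nat k) (Y - 1) (- of_nat n) (X + of_nat k) 1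
    = (\<Sum>j\<le>n - k. L2_term X n k j * pochhammer (Y - 1) j)"
    unfolding top hyp3F2_terminating sum_distrib_left
    by (intro sum.cong refl hyp3F2_term_eq_L2_term) (use assms in auto)
  also have "\<dots> = L2_coeff X Y n k"
    unfolding L2_coeff_def
    by (rule sum.mono_neutral_left) (auto simp: L2_term_eq_0)
  finally show ?thesis .
qed

text \<open>Supplies the nonvanishing hypothesis of \<open>hyp3F2_eq_L2_coeff\<close>:
  \<open>X + i\<close> is a polynomial of degree 1 in \<open>X\<close>.\<close>

lemma indet_X_add_of_nat_neq_0:
  "(indet_X :: 'r::idom poly poly fract) + of_nat i \<noteq> 0"
  by (simp add: indet_X_def of_nat_fract Zero_fract_def eq_fract of_nat_poly)

theorem theorem2p4:
  fixes n :: nat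
  shows "L2 (indet_X :: 'r::{idom,ring_char_0} poly poly fract) indet_Y n =
    (\<Sum>k=0..n. monom
       (pochhammer (indet_X + of_nat k) (n - k) * of_nat (n choose k)
        * hyp3F2 (of_nat k - of_nat n) (of_nat k) (indet_Y - 1)
            (- of_nat n) (indet_X + of_nat k) 1
        * (- 1) ^ (n - k)) k)"
proof (rule poly_eqI)
  fix m
  have "(\<Sum>k=0..n. monom
       (pochhammer (indet_X + of_nat k) (n - k) * of_nat (n choose k)
        * hyp3F2 (of_nat k - of_nat n) (of_nat k) (indet_Y - 1)
            (- of_nat n) (indet_X + of_nat k) 1
        * (- 1) ^ (n - k)) k)
    = (\<Sum>k=0..n. monom (L2_coeff (indet_X :: 'r poly poly fract) indet_Y n k * (- 1) ^ (n - k)) k)"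
    by (intro sum.cong refl) (simp add: hyp3F2_eq_L2_coeff indet_X_add_of_nat_neq_0)
  moreover have "(- 1 :: 'r poly poly fract) ^ (n - m) = (- 1) ^ (n + m)" if "m \<le> n"
    using that by (simp add: minus_one_power_iff)
  ultimately show "coeff (L2 (indet_X :: 'r poly poly fract) indet_Y n) m = coeff (\<Sum>k=0..n. monom
       (pochhammer (indet_X + of_nat k) (n - k) * of_nat (n choose k)
        * hyp3F2 (of_nat k - of_nat n) (of_nat k) (indet_Y - 1)
            (- of_nat n) (indet_X + of_nat k) 1
        * (- 1) ^ (n - k)) k) m"
    by (auto simp: coeff_L2 coeff_sum L2_coeff_eq_0 mult.commute)
qed

end
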